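(* For every integer $n\ge 6$ and every $\varepsilon\in(0,1)$ there exists a family of instances of the exploration problem on weighted trees with $n$ vertices, with predictions satisfying $(1-\varepsilon)d_G(v,g)\le f(v)\le(1+\varepsilon)d_G(v,g)$ for all $v$, such that every (deterministic) exploration algorithm incurs cost $\mathrm{ALG}\ge(1+n\varepsilon)\mathrm{OPT}$ on some instance of the family.
   Context: Exploration setting: an instance consists of a finite undirected tree $G=(V,E)$ with positive edge weights and shortest-path distance $d_G$, a root $r$, an unknown goal $g$ (recognized only upon visiting), and predictions $f:V\to\mathbb{R}$. For $S\subseteq V$, $\partial S$ is the set of vertices outside $S$ adjacent to $S$. Having visited $V_{i-1}$ ($V_0=\{r\}$), the agent knows only the subgraph $G_i$ with vertex set $V_{i-1}\cup\partial V_{i-1}$ and all edges incident to $V_{i-1}$, with the predictions there; it moves to some $v_i\in\partial V_{i-1}$ paying $d_{G_i}(v_{i-1},v_i)$. $\mathrm{ALG}$ is the total distance travelled until $g$ is visited and $\mathrm{OPT}=d_G(r,g)$. *)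

theory Defs
  imports Complex_Main "HOL-Library.FuncSet"
begin

record 'a wgraph =
  verts :: "'a set"
  edges :: "'a set set"
  weight :: "'a set \<Rightarrow> real"

text \<open>Finite simple undirected graphs; an edge is the two-element set of its ends.\<close>

definition weighted_graph :: "'a wgraph \<Rightarrow> bool" where
  "weighted_graph G \<longleftrightarrow>
     finite (verts G) \<and>
     (\<forall>e\<in>edges G. \<exists>u\<in>verts G. \<exists>v\<in>verts G. u \<noteq> v \<and> e = {u, v}) \<and>
     (\<forall>e\<in>edges G. weight G e > 0)"

definition is_path :: "'a wgraph \<Rightarrow> 'a \<Rightarrow> 'a list \<Rightarrow> 'a \<Rightarrow> bool" where
  "is_path G u p v \<longleftrightarrow>
     p \<noteq> [] \<and> hd p = u \<and> last p = v \<and> distinct p \<and> set p \<subseteq> verts G \<and>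
     successively (\<lambda>x y. {x, y} \<in> edges G) p"

definition path_length :: "'a wgraph \<Rightarrow> 'a list \<Rightarrow> real" where
  "path_length G p = sum_list (map2 (\<lambda>x y. weight G {x, y}) p (tl p))"

text \<open>In a finite graph there are only finitely many paths, so the infimum is a minimum whenever
  \<open>u\<close> and \<open>v\<close> are connected; otherwise the value is meaningless.\<close>

definition gdist :: "'a wgraph \<Rightarrow> 'a \<Rightarrow> 'a \<Rightarrow> real" where
  "gdist G u v = Inf {path_length G p | p. is_path G u p v}"

definition connected_graph :: "'a wgraph \<Rightarrow> bool" where
  "connected_graph G \<longleftrightarrow>
     verts G \<noteq> {} \<and> (\<forall>u\<in>verts G. \<forall>v\<in>verts G. \<exists>p. is_path G u p v)"

definition is_cycle :: "'a wgraph \<Rightarrow> 'a list \<Rightarrow> bool" where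
  "is_cycle G c \<longleftrightarrow>
     length c \<ge> 3 \<and> is_path G (hd c) c (last c) \<and> {last c, hd c} \<in> edges G"

definition weighted_tree :: "'a wgraph \<Rightarrow> bool" where
  "weighted_tree G \<longleftrightarrow>
     weighted_graph G \<and> connected_graph G \<and> (\<nexists>c. is_cycle G c)"

definition boundary :: "'a wgraph \<Rightarrow> 'a set \<Rightarrow> 'a set" where
  "boundary G S = {v \<in> verts G - S. \<exists>u\<in>S. {u, v} \<in> edges G}"

text \<open>The part of \<open>G\<close> revealed once \<open>S\<close> has been visited. The weight function is restricted so
  that it carries no information about unrevealed edges.\<close>

definition revealed :: "'a wgraph \<Rightarrow> 'a set \<Rightarrow> 'a wgraph" where
  "revealed G S =
     (let E = {e \<in> edges G. e \<inter> S \<noteq> {}}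
      in \<lparr>verts = S \<union> boundary G S, edges = E, weight = restrict (weight G) E\<rparr>)"

record 'a instance_data =
  graph :: "'a wgraph"
  root :: 'a
  goal :: 'a
  prediction :: "'a \<Rightarrow> real"

text \<open>The case \<open>root = goal\<close> is excluded: there both the optimum and the cost of every algorithm
  are \<open>0\<close>, and any competitive-ratio bound would hold for trivial reasons.\<close>

definition exploration_instance :: "'a instance_data \<Rightarrow> bool" where
  "exploration_instance I \<longleftrightarrow>
     weighted_tree (graph I) \<and> root I \<in> verts (graph I) \<and> goal I \<in> verts (graph I) \<and>
     root I \<noteq> goal I"

text \<open>What the agent knows before its next move: the vertices visited so far in chronological
  order (root first, current position last), the revealed subgraph, and the predictions on it. The
  goal is not part of an observation.\<close>

record 'a observation =
  visited :: "'a list"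
  known_graph :: "'a wgraph"
  known_prediction :: "'a \<Rightarrow> real"

definition observe :: "'a instance_data \<Rightarrow> 'a list \<Rightarrow> 'a observation" where
  "observe I vs =
     (let H = revealed (graph I) (set vs)
      in \<lparr>visited = vs, known_graph = H, known_prediction = restrict (prediction I) (verts H)\<rparr>)"

text \<open>A deterministic strategy maps an observation to the next vertex to visit.\<close>

type_synonym 'a strategy = "'a observation \<Rightarrow> 'a"

primrec visits :: "'a strategy \<Rightarrow> 'a instance_data \<Rightarrow> nat \<Rightarrow> 'a list" where
  "visits A I 0 = [root I]"
| "visits A I (Suc i) = visits A I i @ [A (observe I (visits A I i))]"

text \<open>Until the goal has been visited, every move must lead to a boundary vertex of the visited set;
  what the strategy does afterwards is irrelevant.\<close>

definition exploration_algorithm :: "'a strategy \<Rightarrow> bool" where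
  "exploration_algorithm A \<longleftrightarrow>
     (\<forall>I. exploration_instance I \<longrightarrow>
        (\<forall>i. goal I \<notin> set (visits A I i) \<longrightarrow>
           A (observe I (visits A I i)) \<in> boundary (graph I) (set (visits A I i))))"

text \<open>An exploration algorithm visits a new vertex in every step before reaching the goal, so on an
  exploration instance the \<open>LEAST\<close> below exists.\<close>

definition goal_time :: "'a strategy \<Rightarrow> 'a instance_data \<Rightarrow> nat" where
  "goal_time A I = (LEAST i. goal I \<in> set (visits A I i))"

definition alg_cost :: "'a strategy \<Rightarrow> 'a instance_data \<Rightarrow> real" where
  "alg_cost A I =
     (\<Sum>i<goal_time A I.
        gdist (revealed (graph I) (set (visits A I i)))
          (last (visits A I i)) (last (visits A I (Suc i))))"

definition opt_cost :: "'a instance_data \<Rightarrow> real" where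
  "opt_cost I = gdist (graph I) (root I) (goal I)"

definition predictions_accurate :: "real \<Rightarrow> 'a instance_data \<Rightarrow> bool" where
  "predictions_accurate \<epsilon> I \<longleftrightarrow>
     (\<forall>v\<in>verts (graph I).
        (1 - \<epsilon>) * gdist (graph I) v (goal I) \<le> prediction I v \<and>
        prediction I v \<le> (1 + \<epsilon>) * gdist (graph I) v (goal I))"

end

theory Submission
  imports Defs
begin

text \<open>The instances are spiders: \<open>n - 2\<close> arms of length \<open>\<epsilon>\<close> leave the root, and the goal hangs off
  the end of one of them at distance \<open>1 - \<epsilon>\<close>. The end of the goal's arm is at distance \<open>1 - \<epsilon>\<close>
  from the goal and the other ends at distance \<open>1 + \<epsilon>\<close>; the prediction \<open>(1 - \<epsilon>) * (1 + \<epsilon>)\<close> is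
  admissible for both, so the arms cannot be told apart before they are explored. If the goal is on
  the arm explored last, the cost is \<open>1 + 2 * (n - 3) * \<epsilon>\<close> while the optimum is \<open>1\<close>, and
  \<open>2 * (n - 3) \<ge> n\<close> as \<open>n \<ge> 6\<close>.\<close>

section \<open>Distance estimates by potentials and a criterion for acyclicity\<close>

lemma path_length_simps [simp]:
  "path_length G [] = 0"
  "path_length G [x] = 0"
  "path_length G (x # y # p) = weight G {x, y} + path_length G (y # p)"
  by (simp_all add: path_length_def)

text \<open>Summing the edge inequality along the path telescopes.\<close>

lemma path_length_ge_potential:
  assumes "\<And>x y. {x, y} \<in> edges G \<Longrightarrow> \<phi> x \<le> weight G {x, y} + \<phi> y"
    and "successively (\<lambda>x y. {x, y} \<in> edges G) p" and "p \<noteq> []"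
  shows "\<phi> (hd p) - \<phi> (last p) \<le> path_length G p"
  using assms(2,3)
proof (induction p rule: induct_list012)
  case (3 x y p)
  then show ?case using assms(1)[of x y] by force
qed auto

text \<open>Bounding the infimum over all paths thus takes one check per edge. The path
  \<open>p\<close> makes the infimum range over a nonempty set.\<close>

lemma gdist_ge_potential:
  assumes "is_path G u p v"
    and "\<And>x y. {x, y} \<in> edges G \<Longrightarrow> \<phi> x \<le> weight G {x, y} + \<phi> y"
  shows "\<phi> u - \<phi> v \<le> gdist G u v"
  unfolding gdist_def
proof (rule cInf_greatest)
  fix l assume "l \<in> {path_length G p | p. is_path G u p v}"
  then obtain q where "is_path G u q v" "l = path_length G q" by blast
  then show "\<phi> u - \<phi> v \<le> l"
    using path_length_ge_potential[of G \<phi> q] assms(2) by (auto simp: is_path_def)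
qed (use assms(1) in blast)

lemma gdist_le_path_length:
  assumes "is_path G u p v" and "\<And>e. e \<in> edges G \<Longrightarrow> 0 \<le> weight G e"
  shows "gdist G u v \<le> path_length G p"
  unfolding gdist_def
proof (rule cInf_lower)
  show "bdd_below {path_length G p | p. is_path G u p v}"
  proof (rule bdd_belowI[of _ 0])
    fix l assume "l \<in> {path_length G p | p. is_path G u p v}"
    then show "0 \<le> l"
      using path_length_ge_potential[of G "\<lambda>_. 0"] assms(2) by (fastforce simp: is_path_def)
  qed
qed (use assms(1) in blast)

lemma is_path_rev: "is_path G u p v \<Longrightarrow> is_path G v (rev p) u"
  by (auto simp: is_path_def hd_rev last_rev insert_commute)

text \<open>The largest vertex of a cycle has two smaller neighbours.\<close>

lemma no_cycle_if_unique_smaller_neighbour: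
  fixes G :: "'a::linorder wgraph"
  assumes uniq: "\<And>x y v. {x, v} \<in> edges G \<Longrightarrow> {y, v} \<in> edges G \<Longrightarrow> x < v \<Longrightarrow> y < v \<Longrightarrow> x = y"
  shows "\<nexists>c. is_cycle G c"
proof
  assume "\<exists>c. is_cycle G c"
  then obtain c where c: "is_cycle G c" ..
  define l where "l = length c"
  have l: "l \<ge> 3" and dist: "distinct c" and suc: "successively (\<lambda>x y. {x, y} \<in> edges G) c"
    and close: "{last c, hd c} \<in> edges G"
    using c by (auto simp: is_cycle_def is_path_def l_def)
  have "c \<noteq> []" using l by (auto simp: l_def)
  then have "Max (set c) \<in> set c" by simp
  then obtain i where i: "i < l" "c ! i = Max (set c)" by (auto simp: in_set_conv_nth l_def)
  have step: "{c ! k, c ! Suc k} \<in> edges G" if "Suc k < l" for k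
    using suc that by (simp add: successively_conv_nth l_def)
  have wrap: "{c ! (l - 1), c ! 0} \<in> edges G"
    using close \<open>c \<noteq> []\<close> by (simp add: last_conv_nth hd_conv_nth l_def)
  \<comment> \<open>\<open>a\<close> and \<open>b\<close> are the cyclic neighbours of the position
    \<open>i\<close> of the maximum; they differ because the cycle has at least 3 vertices.\<close>
  define a where "a = (if i = 0 then l - 1 else i - 1)"
  define b where "b = (if i = l - 1 then 0 else Suc i)"
  have ab: "a < l" "b < l" "a \<noteq> i" "b \<noteq> i" "a \<noteq> b"
    using l i(1) by (auto simp: a_def b_def)
  have "{c ! a, c ! i} \<in> edges G" "{c ! b, c ! i} \<in> edges G"
    using step[of a] step[of i] wrap i(1) l
    by (auto simp: a_def b_def insert_commute split: if_splits)
  moreover have "c ! k < c ! i" if "k < l" "k \<noteq> i" for k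
    using that i dist Max_ge[of "set c" "c ! k"]
    by (metis List.finite_set l_def nth_eq_iff_index_eq nth_mem order_le_less)
  ultimately have "c ! a = c ! b" using uniq ab by blast
  then show False using ab dist by (simp add: nth_eq_iff_index_eq l_def)
qed

lemma length_visits [simp]: "length (visits A I i) = Suc i"
  by (induction i) auto

lemma visits_mono: "i \<le> k \<Longrightarrow> set (visits A I i) \<subseteq> set (visits A I k)"
  by (induction k) (auto simp: le_Suc_eq)

lemma root_in_visits: "root I \<in> set (visits A I i)"
  using visits_mono[of 0 i A I] by simp

section \<open>The spider instances and distances to the goal\<close>

locale spiders =
  fixes n :: nat and \<epsilon> :: real
  assumes n: "n \<ge> 6" and eps: "0 < \<epsilon>" "\<epsilon> < 1"
begin

text \<open>Vertex \<open>0\<close> is the root, the vertices in \<open>arms\<close> are the ends of the arms, and \<open>n - 1\<close> is the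
  goal, hanging off arm \<open>j\<close>.\<close>

definition arms :: "nat set" where
  "arms = {0<..<n - 1}"

definition spider :: "nat \<Rightarrow> nat wgraph" where
  "spider j = \<lparr>verts = {..<n}, edges = insert {j, n - 1} ((\<lambda>i. {0, i}) ` arms),
     weight = (\<lambda>e. if 0 \<in> e then \<epsilon> else 1 - \<epsilon>)\<rparr>"

definition inst :: "nat \<Rightarrow> nat instance_data" where
  "inst j = \<lparr>graph = spider j, root = 0, goal = n - 1,
     prediction = (\<lambda>v. if v = 0 then 1 else if v = n - 1 then 0 else (1 - \<epsilon>) * (1 + \<epsilon>))\<rparr>"

text \<open>The common revealed graph while the goal's arm is unexplored. The weight is restricted
  as in \<open>revealed\<close>, so that the two records can be literally equal.\<close>

definition star :: "nat wgraph" where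
  "star = \<lparr>verts = {..<n - 1}, edges = (\<lambda>i. {0, i}) ` arms,
     weight = restrict (\<lambda>e. if 0 \<in> e then \<epsilon> else 1 - \<epsilon>) ((\<lambda>i. {0, i}) ` arms)\<rparr>"

definition goal_dist :: "nat \<Rightarrow> nat \<Rightarrow> real" where
  "goal_dist j v =
     (if v = n - 1 then 0 else if v = j then 1 - \<epsilon> else if v = 0 then 1 else 1 + \<epsilon>)"

lemma inst_simps [simp]:
  "graph (inst j) = spider j" "root (inst j) = 0" "goal (inst j) = n - 1"
  by (simp_all add: inst_def)

lemma verts_spider [simp]: "verts (spider j) = {..<n}"
  by (simp add: spider_def)

lemma weight_spider [simp]: "weight (spider j) e = (if 0 \<in> e then \<epsilon> else 1 - \<epsilon>)"
  by (simp add: spider_def)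

lemma mem_arms: "i \<in> arms \<longleftrightarrow> 0 < i \<and> i < n - 1"
  by (simp add: arms_def)

lemma edge_spider:
  "{x, y} \<in> edges (spider j) \<longleftrightarrow>
     x = 0 \<and> y \<in> arms \<or> y = 0 \<and> x \<in> arms \<or> x = j \<and> y = n - 1 \<or> x = n - 1 \<and> y = j"
  by (auto simp: spider_def doubleton_eq_iff)

lemma edge_star: "{x, y} \<in> edges star \<longleftrightarrow> x = 0 \<and> y \<in> arms \<or> y = 0 \<and> x \<in> arms"
  by (auto simp: star_def doubleton_eq_iff)

lemma weight_star: "e \<in> edges star \<Longrightarrow> weight star e = \<epsilon>"
  by (auto simp: star_def)

lemma path_to_goal:
  assumes "j \<in> arms" "v < n"
  obtains p where "is_path (spider j) v p (n - 1)" "path_length (spider j) p = goal_dist j v"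
proof -
  define p where "p = (if v = n - 1 then [v] else if v = j then [v, n - 1]
    else if v = 0 then [v, j, n - 1] else [v, 0, j, n - 1])"
  have "is_path (spider j) v p (n - 1)" "path_length (spider j) p = goal_dist j v"
    using assms n by (auto simp: p_def is_path_def edge_spider mem_arms goal_dist_def)
  then show thesis using that by blast
qed

lemma goal_dist_potential:
  assumes "j \<in> arms" "{x, y} \<in> edges (spider j)"
  shows "goal_dist j x \<le> weight (spider j) {x, y} + goal_dist j y"
  using assms eps n by (auto simp: edge_spider goal_dist_def mem_arms)

text \<open>An explicit path gives the upper bound; \<open>goal_dist j\<close> itself, used as a
  potential, gives the matching lower bound.\<close>

lemma gdist_goal:
  assumes "j \<in> arms" "v < n"
  shows "gdist (spider j) v (n - 1) = goal_dist j v"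
proof (rule antisym)
  obtain p where p: "is_path (spider j) v p (n - 1)" "path_length (spider j) p = goal_dist j v"
    using path_to_goal assms by blast
  show "gdist (spider j) v (n - 1) \<le> goal_dist j v"
    using gdist_le_path_length[OF p(1)] p(2) eps by auto
  show "goal_dist j v \<le> gdist (spider j) v (n - 1)"
    using gdist_ge_potential[OF p(1), of "goal_dist j"] goal_dist_potential[OF assms(1)]
    by (simp add: goal_dist_def)
qed

section \<open>Admissibility of the instances\<close>

lemma connected_spider:
  assumes "j \<in> arms"
  shows "connected_graph (spider j)"
proof -
  \<comment> \<open>With ordered ends, either \<open>v\<close> is the goal or the goal is not
    involved; reversing paths covers the opposite order.\<close>
  have *: "\<exists>p. is_path (spider j) u p v" if "u \<le> v" "v < n" for u v
  proof (cases "v = n - 1")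
    case True
    then show ?thesis using path_to_goal[OF assms, of u] that by (metis le_less_trans)
  next
    case False
    define p where "p = (if u = v then [u] else if u = 0 then [u, v] else [u, 0, v])"
    have "is_path (spider j) u p v"
      using that False by (auto simp: p_def is_path_def edge_spider mem_arms)
    then show ?thesis ..
  qed
  have "\<exists>p. is_path (spider j) u p v" if "u < n" "v < n" for u v
    using *[of u v] *[of v u] that is_path_rev by (metis nle_le)
  then show ?thesis using n by (auto simp: connected_graph_def lessThan_empty_iff)
qed

lemma tree_spider:
  assumes "j \<in> arms"
  shows "weighted_tree (spider j)"
proof -
  have "\<exists>u\<in>{..<n}. \<exists>v\<in>{..<n}. u \<noteq> v \<and> e = {u, v}" if "e \<in> edges (spider j)" for e
  proof -
    have "e = {j, n - 1} \<or> (\<exists>i\<in>arms. e = {0, i})"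
      using that by (auto simp: spider_def)
    moreover have "j \<noteq> n - 1" "j < n" "n - 1 < n" "0 < n" using assms n by (auto simp: mem_arms)
    moreover have "0 \<noteq> i \<and> i < n" if "i \<in> arms" for i using that by (auto simp: mem_arms)
    ultimately show ?thesis by blast
  qed
  then have "weighted_graph (spider j)"
    using eps by (simp add: weighted_graph_def)
  \<comment> \<open>The only smaller neighbour of an arm's end is the root, and that of the goal is
    \<open>j\<close>.\<close>
  moreover have "\<nexists>c. is_cycle (spider j) c"
    using assms by (intro no_cycle_if_unique_smaller_neighbour) (auto simp: edge_spider mem_arms)
  ultimately show ?thesis using connected_spider[OF assms] by (simp add: weighted_tree_def)
qed

lemma exploration_instance_inst: "j \<in> arms \<Longrightarrow> exploration_instance (inst j)"
  using n by (simp add: exploration_instance_def tree_spider)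

lemma predictions_accurate_inst:
  assumes "j \<in> arms"
  shows "predictions_accurate \<epsilon> (inst j)"
proof -
  let ?f = "prediction (inst j)"
  have "(1 - \<epsilon>) * goal_dist j v \<le> ?f v \<and> ?f v \<le> (1 + \<epsilon>) * goal_dist j v" for v
    using assms eps n by (auto simp: goal_dist_def inst_def mem_arms)
  then show ?thesis
    using assms by (simp add: predictions_accurate_def gdist_goal del: One_nat_def)
qed

lemma opt_cost_inst: "j \<in> arms \<Longrightarrow> opt_cost (inst j) = 1"
  using n by (auto simp: opt_cost_def gdist_goal goal_dist_def mem_arms simp del: One_nat_def)

section \<open>The view of the agent before the goal's arm is explored\<close>

lemma boundary_spider:
  assumes "j \<in> arms" "0 \<in> S" "S \<subseteq> {..<n - 1}" "j \<notin> S"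
  shows "boundary (spider j) S = {..<n - 1} - S"
proof (rule set_eqI)
  fix v
  show "v \<in> boundary (spider j) S \<longleftrightarrow> v \<in> {..<n - 1} - S"
    using assms n by (cases "v = 0") (auto simp: boundary_def edge_spider mem_arms)
qed

text \<open>Every edge \<open>{0, i}\<close> meets \<open>S\<close> in the root, while
  \<open>{j, n - 1}\<close>, the only edge depending on \<open>j\<close>, avoids \<open>S\<close>.
  This makes the instances indistinguishable.\<close>

lemma revealed_spider:
  assumes "j \<in> arms" "0 \<in> S" "S \<subseteq> {..<n - 1}" "j \<notin> S"
  shows "revealed (spider j) S = star"
proof -
  have E: "{e \<in> edges (spider j). e \<inter> S \<noteq> {}} = (\<lambda>i. {0, i}) ` arms"
    using assms by (auto simp: spider_def)
  show ?thesis
    unfolding revealed_def Let_def E boundary_spider[OF assms]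
    using assms(3) by (auto simp: star_def spider_def)
qed

section \<open>Costs of single moves\<close>

lemma gdist_star_root:
  assumes "v \<in> arms"
  shows "gdist star 0 v \<ge> \<epsilon>"
proof -
  have "is_path star 0 [0, v] v"
    using assms by (auto simp: is_path_def edge_star mem_arms) (auto simp: star_def)
  from gdist_ge_potential[OF this, of "\<lambda>x. if x = 0 then \<epsilon> else 0"] show ?thesis
    using assms eps by (auto simp: weight_star mem_arms)
qed

lemma gdist_star_arms:
  assumes "u \<in> arms" "v \<in> arms" "u \<noteq> v"
  shows "gdist star u v \<ge> 2 * \<epsilon>"
proof -
  have "is_path star u [u, 0, v] v"
    using assms by (auto simp: is_path_def edge_star mem_arms) (auto simp: star_def)
  \<comment> \<open>On the vertices of the star, \<open>\<phi>\<close> is the distance to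
    \<open>v\<close>.\<close>
  moreover define \<phi> where "\<phi> = (\<lambda>x. if x = v then 0 else if x = 0 then \<epsilon> else 2 * \<epsilon>)"
  moreover have "\<phi> x \<le> weight star {x, y} + \<phi> y" if "{x, y} \<in> edges star" for x y
    using that assms eps by (auto simp: weight_star edge_star mem_arms \<phi>_def)
  ultimately have "\<phi> u - \<phi> v \<le> gdist star u v"
    by (intro gdist_ge_potential)
  then show ?thesis using assms by (auto simp: \<phi>_def mem_arms)
qed

text \<open>The potential inequality for \<open>goal_dist j\<close> is inherited by the revealed
  subgraph, and \<open>j\<close> in \<open>S\<close> ensures that the edge to the goal is
  revealed.\<close>

lemma gdist_revealed_goal:
  assumes j: "j \<in> arms" and "j \<in> S"
  shows "gdist (revealed (spider j) S) j (n - 1) \<ge> 1 - \<epsilon>"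
proof -
  have E: "{j, n - 1} \<in> edges (spider j)" by (simp add: edge_spider)
  have "n - 1 \<in> S \<union> boundary (spider j) S"
    using assms E n by (auto simp: boundary_def)
  then have p: "is_path (revealed (spider j) S) j [j, n - 1] (n - 1)"
    using assms E by (auto simp: is_path_def revealed_def mem_arms Let_def simp del: One_nat_def)
  have "goal_dist j j - goal_dist j (n - 1) \<le> gdist (revealed (spider j) S) j (n - 1)"
    using goal_dist_potential[OF j]
    by (intro gdist_ge_potential[OF p]) (auto simp: revealed_def Let_def)
  then show ?thesis using j by (simp add: goal_dist_def mem_arms)
qed

section \<open>The adversary argument against a fixed algorithm\<close>

context
  fixes A :: "nat strategy"
  assumes A: "exploration_algorithm A"
begin

lemma move_in_boundary:
  assumes "j \<in> arms" "n - 1 \<notin> set (visits A (inst j) i)"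
  shows "A (observe (inst j) (visits A (inst j) i))
    \<in> boundary (spider j) (set (visits A (inst j) i))"
  using A exploration_instance_inst[OF assms(1)] assms(2)
  unfolding exploration_algorithm_def by fastforce

text \<open>The three claims need one joint induction: while only vertices below
  \<open>n - 1\<close> are visited, the goal is unseen, so the next move must go to the boundary,
  which consists of unvisited star vertices because \<open>j\<close> is unvisited.\<close>

lemma visits_before_arm:
  assumes j: "j \<in> arms" and "j \<notin> set (visits A (inst j) i)"
  shows "set (visits A (inst j) i) \<subseteq> {..<n - 1}" (is ?sub)
    and "distinct (visits A (inst j) i)" (is ?dist)
    and "A (observe (inst j) (visits A (inst j) i)) \<in> {..<n - 1} - set (visits A (inst j) i)"
      (is ?next)
proof -
  have "?sub \<and> ?dist \<and> ?next"
    using assms(2)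
  proof (induction i)
    case 0
    have "A (observe (inst j) (visits A (inst j) 0)) \<in> boundary (spider j) {0}"
      using move_in_boundary[OF j, of 0] n by auto
    then show ?case
      using boundary_spider[OF j, of "{0}"] 0 j n by auto
  next
    case (Suc i)
    let ?S = "set (visits A (inst j) (Suc i))"
    from Suc have IH: "set (visits A (inst j) i) \<subseteq> {..<n - 1}" "distinct (visits A (inst j) i)"
      "A (observe (inst j) (visits A (inst j) i)) \<in> {..<n - 1} - set (visits A (inst j) i)"
      by auto
    then have S: "?S \<subseteq> {..<n - 1}" "distinct (visits A (inst j) (Suc i))" by auto
    moreover have "A (observe (inst j) (visits A (inst j) (Suc i))) \<in> {..<n - 1} - ?S"
      using move_in_boundary[OF j, of "Suc i"] S(1)
        boundary_spider[OF j _ S(1) Suc.prems] root_in_visits[of "inst j" A "Suc i"]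
      by fastforce
    ultimately show ?case by blast
  qed
  then show ?sub ?dist ?next by auto
qed

text \<open>A deterministic strategy moves alike on equal observations, and all instances whose
  \<open>j\<close> is not yet in \<open>vs\<close> yield the same one. Each further move rules out
  at most one candidate \<open>j\<close>.\<close>

lemma run_independent_of_unexplored_goal_arm:
  "\<exists>vs. 0 \<in> set vs \<and> length vs = Suc i \<and> (\<forall>j\<in>arms - set vs. visits A (inst j) i = vs)"
proof (induction i)
  case 0
  show ?case by (intro exI[of _ "[0]"]) simp
next
  case (Suc i)
  then obtain vs where len: "0 \<in> set vs" "length vs = Suc i"
    and vs: "\<And>j. j \<in> arms - set vs \<Longrightarrow> visits A (inst j) i = vs"
    by blast
  \<comment> \<open>The predictions do not depend on the index of \<open>inst\<close>, so 0 is an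
    arbitrary representative.\<close>
  define obs where "obs = \<lparr>visited = vs, known_graph = star,
    known_prediction = restrict (prediction (inst 0)) (verts star)\<rparr>"
  have "observe (inst j) vs = obs" if j: "j \<in> arms - set vs" for j
  proof -
    have "set vs \<subseteq> {..<n - 1}" "0 \<in> set vs"
      using visits_before_arm(1)[of j i] root_in_visits[of "inst j" A i] vs[OF j] j by auto
    then have "revealed (spider j) (set vs) = star"
      using revealed_spider j by blast
    then show ?thesis by (simp add: observe_def obs_def inst_def Let_def)
  qed
  then show ?case using vs len by (intro exI[of _ "vs @ [A obs]"]) auto
qed

text \<open>The common history has \<open>n - 2\<close> entries, one of them the root, so it misses
  one of the \<open>n - 2\<close> arms; the goal is placed there.\<close>

lemma last_arm:
  obtains j where "j \<in> arms" "j \<notin> set (visits A (inst j) (n - 3))"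
proof -
  obtain vs where len: "0 \<in> set vs" "length vs = Suc (n - 3)"
    and vs: "\<And>j. j \<in> arms - set vs \<Longrightarrow> visits A (inst j) (n - 3) = vs"
    using run_independent_of_unexplored_goal_arm[of "n - 3"] by blast
  have "\<not> arms \<subseteq> set vs"
  proof
    assume "arms \<subseteq> set vs"
    moreover have "{..<n - 1} = insert 0 arms" using n by (auto simp: arms_def)
    ultimately have "{..<n - 1} \<subseteq> set vs" using len(1) by simp
    then have "n - 1 \<le> card (set vs)" using card_mono[of "set vs" "{..<n - 1}"] by simp
    then show False using card_length[of vs] len(2) n by linarith
  qed
  then show thesis using that vs by auto
qed

text \<open>All arms are entered before the goal. The first move costs at least
  \<open>\<epsilon>\<close>, each of the next \<open>n - 3\<close> leads from one arm to another and
  costs at least \<open>2 * \<epsilon>\<close>, and the last costs at least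
  \<open>1 - \<epsilon>\<close>.\<close>

lemma alg_cost_last_arm:
  assumes j: "j \<in> arms" and last: "j \<notin> set (visits A (inst j) (n - 3))"
  shows "alg_cost A (inst j) \<ge> 1 + 2 * (real n - 3) * \<epsilon>"
proof -
  let ?V = "visits A (inst j)"
  let ?c = "\<lambda>i. gdist (revealed (spider j) (set (?V i))) (last (?V i)) (last (?V (Suc i)))"
  have unseen: "j \<notin> set (?V i)" if "i \<le> n - 3" for i
    using visits_mono[OF that, of A "inst j"] last by blast
  note before = visits_before_arm[OF j unseen]
  have nonempty: "?V i \<noteq> []" for i
    using length_visits[of A "inst j" i] by fastforce
  \<comment> \<open>Successor forms let \<open>visits\<close> unfold by one move.\<close>
  have Suc_n3: "n - 2 = Suc (n - 3)" "n - 1 = Suc (n - 2)" using n by auto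
  have sub: "set (?V (n - 2)) \<subseteq> {..<n - 1}" and dist: "distinct (?V (n - 2))"
    using before[of "n - 3"] unfolding Suc_n3(1) by auto
  have rev: "revealed (spider j) (set (?V i)) = star" if "i \<le> n - 3" for i
    using revealed_spider[OF j _ before(1) unseen] root_in_visits[of "inst j" A i] that by simp
  have next_arm: "last (?V (Suc i)) \<in> arms - set (?V i)" if "i \<le> n - 3" for i
    using before(3)[OF that] root_in_visits[of "inst j" A i]
    by (auto simp: mem_arms intro: gr0I)
  have cost_first: "?c 0 \<ge> \<epsilon>"
    using gdist_star_root[of "last (?V 1)"] next_arm[of 0] rev[of 0] by simp
  have cost_arm: "?c (Suc i) \<ge> 2 * \<epsilon>" if "Suc i \<le> n - 3" for i
  proof -
    have "last (?V (Suc i)) \<in> arms" using next_arm[of i] that by auto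
    moreover have "last (?V (Suc (Suc i))) \<in> arms - set (?V (Suc i))"
      using next_arm[OF that] .
    moreover have "last (?V (Suc i)) \<in> set (?V (Suc i))" using nonempty last_in_set by blast
    ultimately show ?thesis
      using gdist_star_arms[of "last (?V (Suc i))" "last (?V (Suc (Suc i)))"] rev[OF that] by auto
  qed
  \<comment> \<open>The \<open>n - 1\<close> distinct visited vertices exhaust the star, so
    \<open>j\<close>, still missing one move earlier, is the latest of them.\<close>
  have "card (set (?V (n - 2))) = n - 1"
    using distinct_card[OF dist] n by simp
  then have all: "set (?V (n - 2)) = {..<n - 1}"
    using card_subset_eq[OF _ sub] by simp
  have lastV: "last (?V (n - 2)) = j"
  proof -
    have "j \<in> set (?V (n - 2))" using all j by (simp add: mem_arms)
    then show ?thesis using last unfolding Suc_n3(1) by auto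
  qed
  have goal_unseen: "n - 1 \<notin> set (?V (n - 2))" using all by simp
  have "last (?V (n - 1)) \<in> boundary (spider j) {..<n - 1}"
    using move_in_boundary[OF j goal_unseen] all unfolding Suc_n3(2) by simp
  then have final: "last (?V (n - 1)) = n - 1"
    using n by (auto simp: boundary_def)
  have "last (?V (n - 1)) \<in> set (?V (n - 1))" using nonempty last_in_set by blast
  then have goal_seen: "n - 1 \<in> set (?V (n - 1))" using final by simp
  have time: "goal_time A (inst j) = n - 1"
    unfolding goal_time_def
  proof (rule Least_equality)
    fix i assume "goal (inst j) \<in> set (?V i)"
    then show "n - 1 \<le> i"
      using goal_unseen visits_mono[of i "n - 2" A "inst j"] Suc_n3(2) by force
  qed (use goal_seen in simp)
  have cost_last: "?c (n - 2) \<ge> 1 - \<epsilon>"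
    using gdist_revealed_goal[OF j, of "set (?V (n - 2))"] all lastV final j Suc_n3(2)
    by (simp add: mem_arms)
  have "(\<Sum>i<n - 3. ?c (Suc i)) \<ge> (\<Sum>i<n - 3. 2 * \<epsilon>)"
    by (intro sum_mono cost_arm) auto
  \<comment> \<open>The first move, out of the root, and the last one, to the goal, are separated
    from the \<open>n - 3\<close> moves between arms.\<close>
  moreover have split: "(\<Sum>i<n - 1. c i) = c 0 + (\<Sum>i<n - 3. c (Suc i)) + c (n - 2)"
    for c :: "nat \<Rightarrow> real"
    unfolding Suc_n3(2) sum.lessThan_Suc unfolding Suc_n3(1) sum.lessThan_Suc_shift ..
  moreover have "alg_cost A (inst j) = ?c 0 + (\<Sum>i<n - 3. ?c (Suc i)) + ?c (n - 2)"
    unfolding alg_cost_def time inst_simps using split[of ?c] .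
  ultimately show ?thesis
    using cost_first cost_last n by (simp add: of_nat_diff algebra_simps)
qed

end

end

theorem theorem6:
  fixes n :: nat and \<epsilon> :: real
  assumes "n \<ge> 6" and "0 < \<epsilon>" and "\<epsilon> < 1"
  shows "\<exists>F :: nat instance_data set.
    (\<forall>I\<in>F. exploration_instance I \<and> card (verts (graph I)) = n \<and> predictions_accurate \<epsilon> I) \<and>
    (\<forall>A :: nat strategy. exploration_algorithm A \<longrightarrow>
       (\<exists>I\<in>F. alg_cost A I \<ge> (1 + real n * \<epsilon>) * opt_cost I))"
proof -
  interpret spiders n \<epsilon> using assms by unfold_locales
  have "\<exists>j\<in>arms. alg_cost A (inst j) \<ge> (1 + real n * \<epsilon>) * opt_cost (inst j)"
    if A: "exploration_algorithm A" for A
  proof -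
    obtain j where j: "j \<in> arms" "j \<notin> set (visits A (inst j) (n - 3))"
      using last_arm[OF A] by blast
    have "real n * \<epsilon> \<le> 2 * (real n - 3) * \<epsilon>"
      using assms by (intro mult_right_mono) auto
    then show ?thesis
      using alg_cost_last_arm[OF A j] opt_cost_inst[OF j(1)] j(1) by (intro bexI[of _ j]) auto
  qed
  \<comment> \<open>The family is fixed in advance; only the choice of \<open>j\<close> within it
    depends on \<open>A\<close>.\<close>
  then show ?thesis
    by (intro exI[of _ "inst ` arms"])
      (auto simp: exploration_instance_inst predictions_accurate_inst)
qed

end
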